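(* Let $A>0$, $c_*>0$, $\sigma^2>0$, $s>1/2$ and $0<\kappa<1/8$. Define the minimax risk $$\mathcal{R}_{n,J}\big(\tilde W_s(A,c_* ),\mathcal{G}^{\kappa}\big)=\inf_{\hat f_{n,J}}\ \sup_{g\in\mathcal{G}^{\kappa}}\ \sup_{f\in\tilde W_s(A,c_* )}\mathcal{R}_g(\hat f_{n,J},f),$$ where the infimum is over all estimators $\hat f_{n,J}$ (measurable functions of the observations $(Y_{\ell,j})_{1\le\ell\le n,1\le j\le J}$ with values in $L^2_{\mathrm{per}}([0,1])$). There exists a constant $C>0$ depending only on $A,s,c_*$ and $\sigma^2$ such that $$\liminf_{\min(n,J)\to+\infty}(nJ)^{\frac{2s}{2s+1}}\,\mathcal{R}_{n,J}\big(\tilde W_s(A,c_* ),\mathcal{G}^{\kappa}\big)\ge C.$$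
   Context: Function class. $L^2_{\mathrm{per}}([0,1])$ is the space of real-valued square integrable functions on $[0,1]$, extended to $\mathbb{R}$ by $1$-periodicity; $c_k=\int_0^1 f(t)e^{-i2\pi kt}\,dt$, $k\in\mathbb{Z}$, are the Fourier coefficients of $f$. For $s>1/2$ and $A,c_*>0$, $$\tilde W_s(A,c_* )=\Big\{f\in L^2_{\mathrm{per}}([0,1]):\ \sum_{k\in\mathbb{Z}}(1+|k|^{2s})|c_k|^2\le A^2,\ |c_1|\ge c_*\Big\}$$ (such $f$ are identified with their continuous periodic representative). Shift densities. $\mathcal{G}^{\kappa}$ is the set of probability densities $g$ on $[-\frac12,\frac12]$ with support contained in $[-\kappa/2,\kappa/2]$. Model. One observes $Y_{\ell,j}=f(t_\ell-\theta_j^* )+\varepsilon_{\ell,j}$, $\ell=1,\dots,n$, $j=1,\dots,J$, with $t_\ell=\ell/n$, where the $\theta_j^*$ are i.i.d. with density $g$, and the $\varepsilon_{\ell,j}$ are i.i.d. real Gaussian $N(0,\sigma^2)$, independent of the $\theta_j^*$; $\sigma^2>0$ is known. $\mathbb{E}^g$ denotes expectation under this model. Distance and risk. For $f,h\in L^2_{\mathrm{per}}([0,1])$, with $[f]$ the equivalence class of $f$ under time shifts, $d([f],[h])=\inf_{\theta\in[-1/2,1/2]}\big(\int_0^1|f(t-\theta)-h(t)|^2dt\big)^{1/2}$, and for an estimator $\hat f$, $\mathcal{R}_g(\hat f,f)=\mathbb{E}^g\big(d^2([\hat f],[f])\big)$.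
   Formalization: The hypothesis 2c_* < A is added: since f is real, 4|c_1|² ≤ A², so for A < 2c_* the class is empty and for A = 2c_* it is the shift orbit of 2c_* cos(2πt), where a constant estimator has zero risk; the claim fails in both cases. *)

theory Defs
  imports "HOL-Probability.Probability"
begin

text \<open>Elements of the space of 1-periodic square integrable functions are represented by
  functions on the real line rather than by classes modulo null sets.  Representatives are
  taken Borel measurable, which is no restriction since every class contains one.\<close>

definition L2per :: "(real \<Rightarrow> real) set" where
  "L2per = {f \<in> borel_measurable borel. (\<forall>t. f (t + 1) = f t) \<and>
     set_integrable lborel {0..1} (\<lambda>t. (f t)\<^sup>2)}"

definition L2dist :: "(real \<Rightarrow> real) \<Rightarrow> (real \<Rightarrow> real) \<Rightarrow> real" where
  "L2dist f h = sqrt (LINT t:{0..1}|lborel. \<bar>f t - h t\<bar>\<^sup>2)"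

text \<open>The Borel sigma-algebra of the L2 distance.  As \<open>L2dist\<close> is only a pseudometric on
  representatives, all open sets, hence all measurable sets, are saturated with respect to
  equality almost everywhere.\<close>

definition L2borel :: "(real \<Rightarrow> real) measure" where
  "L2borel = sigma L2per
     {U. U \<subseteq> L2per \<and> (\<forall>f\<in>U. \<exists>e>0. \<forall>h\<in>L2per. L2dist f h < e \<longrightarrow> h \<in> U)}"

definition fourier_coeff :: "(real \<Rightarrow> real) \<Rightarrow> int \<Rightarrow> complex" where
  "fourier_coeff f k =
     (LINT t:{0..1}|lborel. of_real (f t) * exp (- \<i> * of_real (2 * pi * of_int k * t)))"

text \<open>The smoothness class; for \<open>s > 1/2\<close> each of its elements has a unique continuous
  representative, and this is the one selected here.  Because \<open>f\<close> is real-valued, the terms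
  for \<open>k = 1\<close> and \<open>k = -1\<close> contribute \<open>4 * (cmod (fourier_coeff f 1))\<^sup>2\<close> to the sum:
  the class is empty for \<open>A < 2 * c\<close>, and for \<open>A = 2 * c\<close> it consists of the shifts of
  the single function \<open>2 * c * cos (2 * pi * t)\<close>.\<close>

definition Wtilde :: "real \<Rightarrow> real \<Rightarrow> real \<Rightarrow> (real \<Rightarrow> real) set" where
  "Wtilde s A c = {f \<in> L2per. continuous_on UNIV f \<and>
     (\<lambda>k::int. (1 + \<bar>of_int k\<bar> powr (2 * s)) * (cmod (fourier_coeff f k))\<^sup>2) summable_on UNIV \<and>
     (\<Sum>\<^sub>\<infinity>k::int. (1 + \<bar>of_int k\<bar> powr (2 * s)) * (cmod (fourier_coeff f k))\<^sup>2) \<le> A\<^sup>2 \<and>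
     cmod (fourier_coeff f 1) \<ge> c}"

text \<open>Densities on \<open>[-1/2, 1/2]\<close> are extended by 0 to the real line.\<close>

definition shift_densities :: "real \<Rightarrow> (real \<Rightarrow> real) set" where
  "shift_densities \<kappa> = {g \<in> borel_measurable borel. (\<forall>x. 0 \<le> g x) \<and>
     (\<forall>x. x \<notin> {-1/2..1/2} \<longrightarrow> g x = 0) \<and>
     (\<integral>\<^sup>+ x. ennreal (g x) \<partial>lborel) = 1 \<and>
     closure {x. g x \<noteq> 0} \<subseteq> {-\<kappa>/2..\<kappa>/2}}"

text \<open>The joint law of the shifts \<open>\<theta> j\<close> and of the noise variables \<open>\<epsilon> (l, j)\<close>, realised on the
  canonical product space; the risk depends on the underlying probability space only through
  this law.  Note that the second parameter of \<open>normal_density\<close> is the standard deviation.\<close>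

definition model :: "real \<Rightarrow> (real \<Rightarrow> real) \<Rightarrow> nat \<Rightarrow> nat \<Rightarrow>
    ((nat \<Rightarrow> real) \<times> (nat \<times> nat \<Rightarrow> real)) measure" where
  "model \<sigma> g n J =
     (\<Pi>\<^sub>M j\<in>{1..J}. density lborel (\<lambda>x. ennreal (g x))) \<Otimes>\<^sub>M
     (\<Pi>\<^sub>M lj\<in>{1..n} \<times> {1..J}. density lborel (\<lambda>x. ennreal (normal_density 0 \<sigma> x)))"

definition observation :: "(real \<Rightarrow> real) \<Rightarrow> nat \<Rightarrow> nat \<Rightarrow>
    (nat \<Rightarrow> real) \<times> (nat \<times> nat \<Rightarrow> real) \<Rightarrow> nat \<times> nat \<Rightarrow> real" where
  "observation f n J = (\<lambda>(\<theta>, \<epsilon>). \<lambda>(l, j)\<in>{1..n} \<times> {1..J}. f (real l / real n - \<theta> j) + \<epsilon> (l, j))"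

definition estimators :: "nat \<Rightarrow> nat \<Rightarrow> ((nat \<times> nat \<Rightarrow> real) \<Rightarrow> real \<Rightarrow> real) set" where
  "estimators n J = (\<Pi>\<^sub>M lj\<in>{1..n} \<times> {1..J}. borel) \<rightarrow>\<^sub>M L2borel"

definition shift_dist :: "(real \<Rightarrow> real) \<Rightarrow> (real \<Rightarrow> real) \<Rightarrow> real" where
  "shift_dist f h = (INF \<theta>\<in>{-1/2..1/2}. L2dist (\<lambda>t. f (t - \<theta>)) h)"

text \<open>The risk may be infinite for a poor estimator, whence the values in \<open>ennreal\<close>.\<close>

definition risk :: "real \<Rightarrow> (real \<Rightarrow> real) \<Rightarrow> nat \<Rightarrow> nat \<Rightarrow>
    ((nat \<times> nat \<Rightarrow> real) \<Rightarrow> real \<Rightarrow> real) \<Rightarrow> (real \<Rightarrow> real) \<Rightarrow> ennreal" where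
  "risk \<sigma> g n J fhat f =
     (\<integral>\<^sup>+ \<omega>. ennreal ((shift_dist (fhat (observation f n J \<omega>)) f)\<^sup>2) \<partial>model \<sigma> g n J)"

definition minimax_risk :: "real \<Rightarrow> nat \<Rightarrow> nat \<Rightarrow> (real \<Rightarrow> real) set \<Rightarrow> (real \<Rightarrow> real) set \<Rightarrow> ennreal" where
  "minimax_risk \<sigma> n J W G =
     (INF fhat\<in>estimators n J. SUP g\<in>G. SUP f\<in>W. risk \<sigma> g n J fhat f)"

end

theory Submission
  imports Defs
begin

text \<open>The hypotheses are the functions with Fourier coefficients \<open>c\<close> at \<open>\<plusminus>1\<close>, \<open>r\<close> at \<open>\<plusminus>k\<close> for \<open>k\<close> in a
  subset \<open>E\<close> of \<open>{N+1..2N}\<close>, and \<open>0\<close> elsewhere.  Since the moduli of the Fourier coefficients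
  are invariant under shifts, Bessel's inequality bounds the squared shift distance between an
  estimate and such a function from below by the sum over \<open>k\<close> of the squared errors committed in
  estimating the moduli.  This loss is additive over the hypercube of all \<open>E\<close>, so Assouad's
  argument reduces it to pairs \<open>E\<close>, \<open>E \<union> {k}\<close>.  Conditionally on the shifts such a pair gives two
  Gaussian vectors whose means differ by at most \<open>2 * r\<close> in each of the \<open>n * J\<close> coordinates,
  whatever the shifts are, so the two laws cannot be separated when \<open>r\<^sup>2\<close> is a small multiple of
  \<open>1 / (n * J)\<close>.  The risk is then at least of order \<open>N * r\<^sup>2\<close>, and the smoothness constraint allows
  \<open>N\<close> of order \<open>(n * J) powr (1 / (2 * s + 1))\<close>.\<close>

section \<open>Gaussian vectors with different means\<close>

abbreviation normal_measure :: "real \<Rightarrow> real \<Rightarrow> real measure" where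
  "normal_measure \<mu> \<sigma> \<equiv> density lborel (\<lambda>x. ennreal (normal_density \<mu> \<sigma> x))"

lemma emeasure_normal_measure_shift:
  assumes "\<sigma> > 0" and [measurable]: "B \<in> sets borel"
  shows "emeasure (normal_measure 0 \<sigma>) ((\<lambda>x. m + x) -` B) = emeasure (normal_measure m \<sigma>) B"
proof -
  have [measurable]: "(\<lambda>x::real. m + x) -` B \<in> sets borel"
    using measurable_sets[of "\<lambda>x::real. m + x" borel borel B] by simp
  have eq: "normal_density m \<sigma> (m + x) = normal_density 0 \<sigma> x" for x
    by (simp add: normal_density_def)
  have "emeasure (normal_measure m \<sigma>) B = (\<integral>\<^sup>+x. ennreal (normal_density m \<sigma> x) * indicator B x \<partial>lborel)"
    by (simp add: emeasure_density)
  also have "\<dots> = (\<integral>\<^sup>+x. ennreal (normal_density m \<sigma> (m + 1 * x)) * indicator B (m + 1 * x) \<partial>lborel)"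
    by (subst nn_integral_real_affine[where c = 1 and t = m]) auto
  also have "\<dots> = emeasure (normal_measure 0 \<sigma>) ((\<lambda>x. m + x) -` B)"
    by (subst emeasure_density) (auto simp: eq indicator_def intro!: nn_integral_cong)
  finally show ?thesis ..
qed

text \<open>Moves the mean from the integrand into a density with respect to Lebesgue measure, so
  that two hypotheses become integrals over the same measure. The law of the translated noise and
  the measure with product density are both identified with the product of the
  \<open>normal_measure (m i) \<sigma>\<close> by comparing values on boxes.\<close>

lemma nn_integral_PiM_normal_shift:
  fixes m :: "'i \<Rightarrow> real"
  assumes "finite I" "\<sigma> > 0"
    and [measurable]: "F \<in> borel_measurable (\<Pi>\<^sub>M i\<in>I. borel)"
  shows "(\<integral>\<^sup>+ x. F (\<lambda>i\<in>I. m i + x i) \<partial>(\<Pi>\<^sub>M i\<in>I. normal_measure 0 \<sigma>)) =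
    (\<integral>\<^sup>+ y. ennreal (\<Prod>i\<in>I. normal_density (m i) \<sigma> (y i)) * F y \<partial>(\<Pi>\<^sub>M i\<in>I. lborel))"
proof -
  note [simp] = assms(1)
  let ?P0 = "\<Pi>\<^sub>M i\<in>I. normal_measure 0 \<sigma>"
  let ?B = "\<Pi>\<^sub>M i\<in>I. (borel :: real measure)"
  let ?L = "\<Pi>\<^sub>M i\<in>I. (lborel :: real measure)"
  let ?T = "\<lambda>x. \<lambda>i\<in>I. m i + x i"
  let ?d = "\<lambda>y. ennreal (\<Prod>i\<in>I. normal_density (m i) \<sigma> (y i))"
  have setsP: "sets ?P0 = sets ?B" "sets ?L = sets ?B"
    by (auto intro!: sets_PiM_cong)
  have T: "?T \<in> ?P0 \<rightarrow>\<^sub>M ?B" by measurable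
  have d: "?d \<in> borel_measurable ?L" by measurable
  have F: "F \<in> borel_measurable ?L" using assms(3) measurable_cong_sets[OF setsP(2) refl] by blast
  interpret P0: product_prob_space "\<lambda>_::'i. normal_measure 0 \<sigma>"
    by (rule product_prob_spaceI) (rule prob_space_normal_density[OF assms(2)])
  interpret Pm: product_prob_space "\<lambda>i::'i. normal_measure (m i) \<sigma>"
    by (rule product_prob_spaceI) (rule prob_space_normal_density[OF assms(2)])
  interpret L: product_sigma_finite "\<lambda>_::'i. lborel :: real measure"
    by standard
  have 1: "distr ?P0 ?B ?T = (\<Pi>\<^sub>M i\<in>I. normal_measure (m i) \<sigma>)"
  proof (rule Pm.PiM_eqI)
    show "sets (distr ?P0 ?B ?T) = sets (\<Pi>\<^sub>M i\<in>I. normal_measure (m i) \<sigma>)"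
      by (auto intro!: sets_PiM_cong)
    fix A assume "\<And>i. i \<in> I \<Longrightarrow> A i \<in> sets (normal_measure (m i) \<sigma>)"
    hence A: "A i \<in> sets borel" if "i \<in> I" for i using that by simp
    have A': "(\<lambda>x. m i + x) -` A i \<in> sets borel" if "i \<in> I" for i
      using measurable_sets[of "\<lambda>x::real. m i + x" borel borel "A i"] A[OF that] by simp
    have "emeasure (distr ?P0 ?B ?T) (Pi\<^sub>E I A) = emeasure ?P0 (?T -` Pi\<^sub>E I A \<inter> space ?P0)"
      using A by (intro emeasure_distr T sets_PiM_I_finite) auto
    also have "?T -` Pi\<^sub>E I A \<inter> space ?P0 = (\<Pi>\<^sub>E i\<in>I. (\<lambda>x. m i + x) -` A i)"
      by (auto simp: space_PiM PiE_def Pi_def extensional_def)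
    also have "emeasure ?P0 \<dots> = (\<Prod>i\<in>I. emeasure (normal_measure 0 \<sigma>) ((\<lambda>x. m i + x) -` A i))"
      using A' by (intro P0.emeasure_PiM) auto
    also have "\<dots> = (\<Prod>i\<in>I. emeasure (normal_measure (m i) \<sigma>) (A i))"
      using A by (intro prod.cong refl emeasure_normal_measure_shift assms)
    finally show "emeasure (distr ?P0 ?B ?T) (Pi\<^sub>E I A) = \<dots>" .
  qed simp
  have 2: "density ?L ?d = (\<Pi>\<^sub>M i\<in>I. normal_measure (m i) \<sigma>)"
  proof (rule Pm.PiM_eqI)
    show "sets (density ?L ?d) = sets (\<Pi>\<^sub>M i\<in>I. normal_measure (m i) \<sigma>)"
      by (auto intro!: sets_PiM_cong)
    fix A assume "\<And>i. i \<in> I \<Longrightarrow> A i \<in> sets (normal_measure (m i) \<sigma>)"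
    hence A[measurable]: "A i \<in> sets borel" if "i \<in> I" for i using that by simp
    have "emeasure (density ?L ?d) (Pi\<^sub>E I A) = (\<integral>\<^sup>+y. ?d y * indicator (Pi\<^sub>E I A) y \<partial>?L)"
      using A d by (intro emeasure_density sets_PiM_I_finite) auto
    also have "\<dots> = (\<integral>\<^sup>+y. (\<Prod>i\<in>I. ennreal (normal_density (m i) \<sigma> (y i)) * indicator (A i) (y i)) \<partial>?L)"
    proof (intro nn_integral_cong)
      fix y assume y: "y \<in> space ?L"
      \<comment> \<open>Points of the product space are extensional, so membership in the box is
        decided coordinate by coordinate.\<close>
      have "indicator (Pi\<^sub>E I A) y = (\<Prod>i\<in>I. indicator (A i) (y i) :: ennreal)"
      proof (cases "y \<in> Pi\<^sub>E I A")
        case True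
        hence "(\<Prod>i\<in>I. indicator (A i) (y i) :: ennreal) = 1"
          by (intro prod.neutral) (auto simp: PiE_def Pi_def)
        thus ?thesis using True by simp
      next
        case False
        then obtain i where "i \<in> I" "y i \<notin> A i" using y by (auto simp: space_PiM PiE_def Pi_def)
        thus ?thesis using False by (auto intro!: prod_zero[symmetric] simp: indicator_def)
      qed
      thus "?d y * indicator (Pi\<^sub>E I A) y = (\<Prod>i\<in>I. ennreal (normal_density (m i) \<sigma> (y i)) * indicator (A i) (y i))"
        by (simp add: prod.distrib prod_ennreal)
    qed
    also have "\<dots> = (\<Prod>i\<in>I. \<integral>\<^sup>+x. ennreal (normal_density (m i) \<sigma> x) * indicator (A i) x \<partial>lborel)"
      by (intro L.product_nn_integral_prod) auto
    also have "\<dots> = (\<Prod>i\<in>I. emeasure (normal_measure (m i) \<sigma>) (A i))"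
      by (intro prod.cong refl emeasure_density[symmetric]) auto
    finally show "emeasure (density ?L ?d) (Pi\<^sub>E I A) = \<dots>" .
  qed simp
  have "(\<integral>\<^sup>+ x. F (?T x) \<partial>?P0) = (\<integral>\<^sup>+ y. F y \<partial>distr ?P0 ?B ?T)"
    using assms(3) by (subst nn_integral_distr[OF T]) simp_all
  also have "\<dots> = (\<integral>\<^sup>+ y. F y \<partial>density ?L ?d)" unfolding 1 2 ..
  also have "\<dots> = (\<integral>\<^sup>+ y. ?d y * F y \<partial>?L)"
    by (rule nn_integral_density[OF d F])
  finally show ?thesis .
qed

text \<open>Completing the square: (x - a)^2 + (x - b)^2 = 2 (x - (a + b)/2)^2 + (a - b)^2/2. The
  geometric mean of the two densities is thus a multiple of the normal density at the midpoint, and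
  the exponential factor is the Hellinger affinity.\<close>

lemma sqrt_normal_density_prod:
  assumes "\<sigma> > 0"
  shows "sqrt ((\<Prod>i\<in>I. normal_density (m i) \<sigma> (y i)) * (\<Prod>i\<in>I. normal_density (m' i) \<sigma> (y i))) =
    exp (- (\<Sum>i\<in>I. (m i - m' i)\<^sup>2) / (8 * \<sigma>\<^sup>2)) * (\<Prod>i\<in>I. normal_density ((m i + m' i) / 2) \<sigma> (y i))"
\<comment> \<open>For infinite \<open>I\<close> the sum defaults to 0 and the products to 1, so the
  identity reads 1 = 1.\<close>
proof (cases "finite I")
  case True
  have eq: "normal_density a \<sigma> x * normal_density b \<sigma> x =
      (exp (- (a - b)\<^sup>2 / (8 * \<sigma>\<^sup>2)) * normal_density ((a + b) / 2) \<sigma> x)\<^sup>2" for a b x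
  proof -
    have e: "- (x - a)\<^sup>2 / (2 * \<sigma>\<^sup>2) + (- (x - b)\<^sup>2 / (2 * \<sigma>\<^sup>2)) =
      2 * (- (a - b)\<^sup>2 / (8 * \<sigma>\<^sup>2) + (- (x - (a + b) / 2)\<^sup>2 / (2 * \<sigma>\<^sup>2)))"
      using assms by (simp add: field_simps power2_eq_square)
    have "normal_density a \<sigma> x * normal_density b \<sigma> x = (1 / sqrt (2 * pi * \<sigma>\<^sup>2))\<^sup>2 *
      exp (- (x - a)\<^sup>2 / (2 * \<sigma>\<^sup>2) + (- (x - b)\<^sup>2 / (2 * \<sigma>\<^sup>2)))"
      unfolding normal_density_def exp_add by (simp add: power2_eq_square)
    also have "\<dots> = (1 / sqrt (2 * pi * \<sigma>\<^sup>2))\<^sup>2 *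
       (exp (- (a - b)\<^sup>2 / (8 * \<sigma>\<^sup>2) + (- (x - (a + b) / 2)\<^sup>2 / (2 * \<sigma>\<^sup>2))))\<^sup>2"
      unfolding e exp_double ..
    also have "\<dots> = (exp (- (a - b)\<^sup>2 / (8 * \<sigma>\<^sup>2)) * normal_density ((a + b) / 2) \<sigma> x)\<^sup>2"
      unfolding normal_density_def exp_add by (simp add: power_mult_distrib power_divide)
    finally show ?thesis .
  qed
  have "(\<Prod>i\<in>I. normal_density (m i) \<sigma> (y i)) * (\<Prod>i\<in>I. normal_density (m' i) \<sigma> (y i)) =
     (\<Prod>i\<in>I. exp (- (m i - m' i)\<^sup>2 / (8 * \<sigma>\<^sup>2)) * normal_density ((m i + m' i) / 2) \<sigma> (y i))\<^sup>2"
    by (simp add: prod.distrib[symmetric] eq prod_power_distrib)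
  also have "(\<Prod>i\<in>I. exp (- (m i - m' i)\<^sup>2 / (8 * \<sigma>\<^sup>2)) * normal_density ((m i + m' i) / 2) \<sigma> (y i)) =
    exp (- (\<Sum>i\<in>I. (m i - m' i)\<^sup>2) / (8 * \<sigma>\<^sup>2)) * (\<Prod>i\<in>I. normal_density ((m i + m' i) / 2) \<sigma> (y i))"
    using True by (simp add: prod.distrib exp_sum sum_divide_distrib sum_negf[symmetric])
  finally show ?thesis
    by (simp add: real_sqrt_abs abs_mult prod_nonneg)
qed simp

text \<open>The sum of the two risks is compared with the Hellinger affinity
  of the two normal laws by the inequality of arithmetic and geometric means, applied to
  \<open>\<bar>\<phi>\<bar> * sqrt (p * q)\<close> and \<open>\<bar>\<phi> - r\<bar> * sqrt (p * q)\<close>.\<close>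

lemma normal_two_point:
  fixes m m' :: "'i \<Rightarrow> real" and \<phi> :: "('i \<Rightarrow> real) \<Rightarrow> real"
  assumes "finite I" "\<sigma> > 0" "r \<ge> 0" and [measurable]: "\<phi> \<in> borel_measurable (\<Pi>\<^sub>M i\<in>I. borel)"
    and close: "(\<Sum>i\<in>I. (m i - m' i)\<^sup>2) \<le> 2 * \<sigma>\<^sup>2"
  shows "(\<integral>\<^sup>+ x. ennreal ((\<phi> (\<lambda>i\<in>I. m i + x i))\<^sup>2) \<partial>(\<Pi>\<^sub>M i\<in>I. normal_measure 0 \<sigma>)) +
    (\<integral>\<^sup>+ x. ennreal ((\<phi> (\<lambda>i\<in>I. m' i + x i) - r)\<^sup>2) \<partial>(\<Pi>\<^sub>M i\<in>I. normal_measure 0 \<sigma>)) \<ge> ennreal (r\<^sup>2 / 4)"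
proof -
  let ?P0 = "\<Pi>\<^sub>M i\<in>I. normal_measure 0 \<sigma>"
  let ?L = "\<Pi>\<^sub>M i\<in>I. (lborel :: real measure)"
  define d where "d = (\<lambda>(m :: 'i \<Rightarrow> real) y. \<Prod>i\<in>I. normal_density (m i) \<sigma> (y i))"
  have d0: "d m y \<ge> 0" for m y by (auto simp: d_def intro!: prod_nonneg)
  have dm[measurable]: "d m \<in> borel_measurable ?L" for m
    unfolding d_def by measurable
  have "sets ?L = sets (\<Pi>\<^sub>M i\<in>I. (borel :: real measure))" by (auto intro!: sets_PiM_cong)
  from measurable_cong_sets[OF this refl] have phm[measurable]: "\<phi> \<in> borel_measurable ?L"
    using assms(4) by blast
  have int: "(\<integral>\<^sup>+ x. F (\<lambda>i\<in>I. m i + x i) \<partial>?P0) = (\<integral>\<^sup>+ y. ennreal (d m y) * F y \<partial>?L)"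
    if "F \<in> borel_measurable (\<Pi>\<^sub>M i\<in>I. borel)" for m F
    unfolding d_def by (rule nn_integral_PiM_normal_shift[OF assms(1,2) that])
  interpret P0: prob_space ?P0
    by (intro prob_space_PiM prob_space_normal_density assms)
  have one: "(\<integral>\<^sup>+ y. ennreal (d m y) \<partial>?L) = 1" for m
    using int[of "\<lambda>_. 1" m] P0.emeasure_space_1 by simp
  define m0 where "m0 = (\<lambda>i. (m i + m' i) / 2)"
  \<comment> \<open>After integration the left side is 3/4 r^2 and the term added to the two risks
    is r^2/2, which leaves r^2/4.\<close>
  have pw: "3 / 4 * r\<^sup>2 * d m0 y \<le> d m y * (\<phi> y)\<^sup>2 + d m' y * (\<phi> y - r)\<^sup>2 + r\<^sup>2 / 4 * (d m y + d m' y)"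
    for y
  proof -
    define p q where "p = sqrt (d m y)" and "q = sqrt (d m' y)"
    have pq: "p \<ge> 0" "q \<ge> 0" "d m y = p\<^sup>2" "d m' y = q\<^sup>2" using d0 by (auto simp: p_def q_def)
    \<comment> \<open>By \<open>close\<close> the exponent of the affinity is at least -1/4, and exp
      u \<ge> 1 + u bounds the affinity below by 3/4.\<close>
    have "(\<Sum>i\<in>I. (m i - m' i)\<^sup>2) / (8 * \<sigma>\<^sup>2) \<le> 1 / 4"
      using close assms(2) by (simp add: field_simps)
    hence "3 / 4 \<le> exp (- (\<Sum>i\<in>I. (m i - m' i)\<^sup>2) / (8 * \<sigma>\<^sup>2))"
      using exp_ge_add_one_self[of "- (\<Sum>i\<in>I. (m i - m' i)\<^sup>2) / (8 * \<sigma>\<^sup>2)"] by simp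
    hence "3 / 4 * d m0 y \<le> p * q"
      using sqrt_normal_density_prod[OF assms(2), where I = I and m = m and m' = m' and y = y] d0[of m0 y]
      unfolding p_def q_def real_sqrt_mult[symmetric] d_def m0_def
      by (simp only: mult_right_mono)
    hence "r\<^sup>2 * (3 / 4 * d m0 y) \<le> r\<^sup>2 * (p * q)" by (rule mult_left_mono) simp
    \<comment> \<open>Triangle inequality: the distances of \<open>\<phi> y\<close> to 0 and to
      \<open>r\<close> add up to at least \<open>r\<close>.\<close>
    moreover have "r\<^sup>2 * (p * q) \<le> r * ((\<bar>\<phi> y\<bar> + \<bar>\<phi> y - r\<bar>) * (p * q))"
      unfolding power2_eq_square mult.assoc using pq assms(3)
      by (intro mult_left_mono mult_right_mono) auto
    moreover have "0 \<le> (\<bar>\<phi> y\<bar> * p - r / 2 * q)\<^sup>2" "0 \<le> (\<bar>\<phi> y - r\<bar> * q - r / 2 * p)\<^sup>2" by auto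
    hence "r * (\<bar>\<phi> y\<bar> * (p * q)) \<le> p\<^sup>2 * (\<phi> y)\<^sup>2 + r\<^sup>2 / 4 * q\<^sup>2"
      "r * (\<bar>\<phi> y - r\<bar> * (p * q)) \<le> q\<^sup>2 * (\<phi> y - r)\<^sup>2 + r\<^sup>2 / 4 * p\<^sup>2"
      unfolding power2_diff power_mult_distrib power2_abs by (simp_all add: algebra_simps power_divide)
    ultimately show ?thesis unfolding pq(3,4) by (simp add: algebra_simps)
  qed
  let ?a = "\<integral>\<^sup>+ x. ennreal ((\<phi> (\<lambda>i\<in>I. m i + x i))\<^sup>2) \<partial>?P0"
  let ?b = "\<integral>\<^sup>+ x. ennreal ((\<phi> (\<lambda>i\<in>I. m' i + x i) - r)\<^sup>2) \<partial>?P0"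
  have "ennreal (3 / 4 * r\<^sup>2) = (\<integral>\<^sup>+ y. ennreal (3 / 4 * r\<^sup>2) * ennreal (d m0 y) \<partial>?L)"
    by (subst nn_integral_cmult) (auto simp: one)
  also have "\<dots> \<le> (\<integral>\<^sup>+ y. (ennreal (d m y) * ennreal ((\<phi> y)\<^sup>2) + ennreal (d m' y) * ennreal ((\<phi> y - r)\<^sup>2)) +
      ennreal (r\<^sup>2 / 4) * (ennreal (d m y) + ennreal (d m' y)) \<partial>?L)"
    using pw d0 by (intro nn_integral_mono)
      (simp add: ennreal_mult'[symmetric] ennreal_plus[symmetric] del: ennreal_plus)
  also have "\<dots> = (?a + ?b) + ennreal (r\<^sup>2 / 4) * (1 + 1)"
    by (simp add: nn_integral_add nn_integral_cmult one int[symmetric])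
  also have "ennreal (r\<^sup>2 / 4) * (1 + 1) = ennreal (r\<^sup>2 / 2)"
    unfolding distrib_left mult_1_right by (subst ennreal_plus[symmetric]) auto
  finally have le: "ennreal (3 / 4 * r\<^sup>2) \<le> (?a + ?b) + ennreal (r\<^sup>2 / 2)" .
  \<comment> \<open>The risks \<open>?a\<close> and \<open>?b\<close> may be infinite, so only the
    finite constant r^2/2 is cancelled.\<close>
  have "ennreal (r\<^sup>2 / 4) + ennreal (r\<^sup>2 / 2) = ennreal (3 / 4 * r\<^sup>2)"
    by (simp add: ennreal_plus[symmetric] del: ennreal_plus)
  with le have "ennreal (r\<^sup>2 / 2) + ennreal (r\<^sup>2 / 4) \<le> ennreal (r\<^sup>2 / 2) + (?a + ?b)"
    by (simp add: add.commute)
  thus ?thesis by (simp add: ennreal_add_left_cancel_le)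
qed

section \<open>Fourier coefficients and the shift distance\<close>

abbreviation unit_measure :: "real measure" where
  "unit_measure \<equiv> restrict_space lborel {0..1}"

lemma integrable_unit_measure_iff:
  fixes f :: "real \<Rightarrow> 'a::{banach, second_countable_topology}"
  shows "integrable unit_measure f \<longleftrightarrow> set_integrable lborel {0..1} f"
  by (subst integrable_restrict_space) (auto simp: set_integrable_def)

lemma integral_unit_measure:
  fixes f :: "real \<Rightarrow> 'a::{banach, second_countable_topology}"
  shows "integral\<^sup>L unit_measure f = (LINT t:{0..1}|lborel. f t)"
  by (subst integral_restrict_space) (auto simp: set_lebesgue_integral_def)

text \<open>Orthonormality of the characters, since the product of one with the conjugate of another
  is the character of the difference of frequencies. For nonzero \<open>k\<close> the antiderivative
  is 1-periodic and takes the same value at both end points.\<close>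

lemma integral_cis_unit:
  "integral\<^sup>L unit_measure (\<lambda>t. cis (2 * pi * of_int k * t)) = (if k = 0 then 1 else 0)"
proof (cases "k = 0")
  case True
  thus ?thesis by (simp add: measure_restrict_space)
next
  case False
  define F :: "real \<Rightarrow> complex"
    where "F = (\<lambda>t. cis (2 * pi * of_int k * t) / (\<i> * of_real (2 * pi * of_int k)))"
  have "(LINT t|lborel. indicator {0..1} t *\<^sub>R cis (2 * pi * of_int k * t)) = F 1 - F 0"
  proof (rule integral_FTC_Icc)
    fix x :: real
    show "(F has_vector_derivative cis (2 * pi * of_int k * x)) (at x within {0..1})"
    proof -
      let ?a = "2 * of_real pi * of_int k :: complex"
      have "((\<lambda>z. exp (\<i> * ?a * z) / (\<i> * ?a)) has_field_derivative exp (\<i> * ?a * of_real x)) (at (of_real x))"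
        using False by (auto intro!: derivative_eq_intros)
      from has_vector_derivative_real_field[OF this] show ?thesis
        by (simp add: F_def cis_conv_exp mult.assoc)
    qed
  qed (auto intro!: continuous_intros)
  also have "F 1 - F 0 = 0"
    using cis_multiple_2pi[of "of_int k"] by (simp add: F_def)
  finally show ?thesis using False
    by (simp add: integral_unit_measure set_lebesgue_integral_def)
qed

lemma integrable_unit_measure_continuous:
  fixes f :: "real \<Rightarrow> 'a::{banach, second_countable_topology}"
  assumes "continuous_on UNIV f"
  shows "integrable unit_measure f"
  unfolding integrable_unit_measure_iff set_integrable_def
  by (rule borel_integrable_compact) (auto intro: continuous_on_subset[OF assms])

lemma fourier_coeff_unit_measure:
  "fourier_coeff f k = integral\<^sup>L unit_measure (\<lambda>t. of_real (f t) * cis (- (2 * pi * of_int k * t)))"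
  by (simp add: fourier_coeff_def integral_unit_measure cis_conv_exp)

text \<open>On a finite measure space square integrability implies integrability, here through |x|
  \<le> x^2 + 1. The Fourier coefficients of elements of \<open>L2per\<close> are therefore genuine
  integrals and linear in the function.\<close>

lemma integrable_square_times_cis:
  assumes [measurable]: "h \<in> borel_measurable borel" and "set_integrable lborel {0..1} (\<lambda>t. (h t)\<^sup>2)"
  shows "integrable unit_measure (\<lambda>t. complex_of_real (h t) * cis (a * t))"
proof (rule Bochner_Integration.integrable_bound)
  show "integrable unit_measure (\<lambda>t. (h t)\<^sup>2 + 1)"
    using assms(2) by (intro Bochner_Integration.integrable_add)
      (auto simp: integrable_unit_measure_iff intro!: integrable_unit_measure_continuous[THEN integrable_unit_measure_iff[THEN iffD1]] continuous_intros)
  have "(\<lambda>t. complex_of_real (h t) * cis (a * t)) \<in> borel_measurable borel"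
    unfolding cis_conv_exp by measurable
  thus "(\<lambda>t. complex_of_real (h t) * cis (a * t)) \<in> borel_measurable unit_measure"
    by (intro measurable_restrict_space1) simp
  have "\<bar>x\<bar> \<le> x\<^sup>2 + 1" for x :: real
    using zero_le_power2[of "\<bar>x\<bar> - 1"] unfolding power2_diff power2_abs by simp
  thus "AE t in unit_measure. norm (complex_of_real (h t) * cis (a * t)) \<le> norm ((h t)\<^sup>2 + 1)"
    by (simp add: norm_mult)
qed

text \<open>The mean square distance from \<open>h\<close> to its Fourier polynomial
  \<open>p\<close> over \<open>K\<close> is nonnegative, and orthonormality evaluates it as the
  integral of h^2 minus the sum of the squared moduli.\<close>

lemma bessel_inequality:
  assumes [measurable]: "h \<in> borel_measurable borel"
    and h2: "set_integrable lborel {0..1} (\<lambda>t. (h t)\<^sup>2)" and K: "finite K"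
  shows "(\<Sum>k\<in>K. (cmod (fourier_coeff h k))\<^sup>2) \<le> (LINT t:{0..1}|lborel. (h t)\<^sup>2)"
proof -
  let ?U = unit_measure
  define c where "c = fourier_coeff h"
  define e where "e = (\<lambda>k t. cis (2 * pi * of_int k * t))"
  define p where "p = (\<lambda>t. \<Sum>k\<in>K. c k * e k t)"
  have he: "integrable ?U (\<lambda>t. complex_of_real (h t) * cnj (e k t))" for k
    using integrable_square_times_cis[OF assms(1,2), of "- (2 * pi * of_int k)"]
    by (simp add: e_def cis_cnj)
  have ce: "integral\<^sup>L ?U (\<lambda>t. complex_of_real (h t) * cnj (e k t)) = c k" for k
    by (simp add: e_def cis_cnj c_def fourier_coeff_unit_measure)
  have ee: "e k t * cnj (e l t) = e (k - l) t" for k l t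
    by (simp add: e_def cis_cnj cis_mult algebra_simps)
  have ei: "integrable ?U (e k)" for k
    unfolding e_def by (intro integrable_unit_measure_continuous continuous_intros)
  have h2': "integrable ?U (\<lambda>t. (h t)\<^sup>2)" using h2 by (simp add: integrable_unit_measure_iff)
  \<comment> \<open>The double sum is written with the characters \<open>e (k - l)\<close>, so that
    only its diagonal survives integration.\<close>
  have expand: "(cmod (complex_of_real (h t) - p t))\<^sup>2 = (h t)\<^sup>2 -
      2 * Re (\<Sum>k\<in>K. cnj (c k) * (complex_of_real (h t) * cnj (e k t))) +
      Re (\<Sum>k\<in>K. \<Sum>l\<in>K. c k * cnj (c l) * e (k - l) t)" for t
  proof -
    have "(cmod (complex_of_real (h t) - p t))\<^sup>2 = (h t)\<^sup>2 - 2 * Re (complex_of_real (h t) * cnj (p t)) + Re (p t * cnj (p t))"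
      by (simp add: cmod_power2) (simp add: power2_eq_square algebra_simps)
    also have "p t * cnj (p t) = (\<Sum>k\<in>K. \<Sum>l\<in>K. c k * cnj (c l) * e (k - l) t)"
      unfolding p_def cnj_sum sum_product ee[symmetric] by (simp add: mult_ac)
    also have "complex_of_real (h t) * cnj (p t) = (\<Sum>k\<in>K. cnj (c k) * (complex_of_real (h t) * cnj (e k t)))"
      unfolding p_def cnj_sum sum_distrib_left by (simp add: mult_ac)
    finally show ?thesis .
  qed
  have i1: "integrable ?U (\<lambda>t. \<Sum>k\<in>K. cnj (c k) * (complex_of_real (h t) * cnj (e k t)))"
    by (intro Bochner_Integration.integrable_sum integrable_mult_right he)
  have i2: "integrable ?U (\<lambda>t. \<Sum>k\<in>K. \<Sum>l\<in>K. c k * cnj (c l) * e (k - l) t)"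
    by (intro Bochner_Integration.integrable_sum integrable_mult_right ei)
  have v1: "integral\<^sup>L ?U (\<lambda>t. \<Sum>k\<in>K. cnj (c k) * (complex_of_real (h t) * cnj (e k t))) = (\<Sum>k\<in>K. cnj (c k) * c k)"
    by (subst Bochner_Integration.integral_sum)
      (auto intro!: integrable_mult_right he sum.cong simp: ce)
  have "integral\<^sup>L ?U (\<lambda>t. \<Sum>k\<in>K. \<Sum>l\<in>K. c k * cnj (c l) * e (k - l) t) =
      (\<Sum>k\<in>K. \<Sum>l\<in>K. c k * cnj (c l) * integral\<^sup>L ?U (e (k - l)))"
    by (simp add: Bochner_Integration.integral_sum integrable_mult_right ei)
  also have "\<dots> = (\<Sum>k\<in>K. \<Sum>l\<in>K. if k = l then c k * cnj (c l) else 0)"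
    unfolding e_def integral_cis_unit by (intro sum.cong refl) auto
  also have "\<dots> = (\<Sum>k\<in>K. cnj (c k) * c k)"
    using K by (intro sum.cong refl) (simp add: mult.commute)
  finally have v2: "integral\<^sup>L ?U (\<lambda>t. \<Sum>k\<in>K. \<Sum>l\<in>K. c k * cnj (c l) * e (k - l) t) = (\<Sum>k\<in>K. cnj (c k) * c k)" .
  have "0 \<le> integral\<^sup>L ?U (\<lambda>t. (cmod (complex_of_real (h t) - p t))\<^sup>2)" by simp
  \<comment> \<open>Cross term and square of \<open>p\<close> integrate to the same sum by
    \<open>v1\<close> and \<open>v2\<close>; it enters with factors -2 and 1.\<close>
  also have "\<dots> = integral\<^sup>L ?U (\<lambda>t. (h t)\<^sup>2) - 2 * Re (\<Sum>k\<in>K. cnj (c k) * c k) + Re (\<Sum>k\<in>K. cnj (c k) * c k)"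
    unfolding expand v1[symmetric] using h2' i1 i2
    by (simp only: Bochner_Integration.integral_add Bochner_Integration.integral_diff integral_mult_right_zero
        integrable_Re integral_Re Bochner_Integration.integrable_diff integrable_mult_right v2)
       (simp add: v1)
  also have "Re (\<Sum>k\<in>K. cnj (c k) * c k) = (\<Sum>k\<in>K. (cmod (c k))\<^sup>2)"
    by (simp add: cmod_power2) (simp add: power2_eq_square)
  finally show ?thesis by (simp add: c_def integral_unit_measure)
qed

section \<open>Shifts of periodic functions\<close>

lemma
  fixes F :: "real \<Rightarrow> 'a::{banach, second_countable_topology}"
  assumes per: "\<And>t. F (t + 1) = F t" and F: "set_integrable lborel {0..1} F"
    and \<theta>: "\<theta> \<in> {-1/2..1/2}"
  shows set_integrable_periodic_shift: "set_integrable lborel {0..1} (\<lambda>t. F (t - \<theta>))"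
    and set_integral_periodic_shift: "(LINT t:{0..1}|lborel. F (t - \<theta>)) = (LINT t:{0..1}|lborel. F t)"
proof -
  \<comment> \<open>The window [a, a + 1] is cut at 1, and its part beyond 1 is moved back by one
    period.\<close>
  have main: "set_integrable lborel {0..1} (\<lambda>t. F (t + a)) \<and>
     (LINT t:{0..1}|lborel. F (t + a)) = (LINT t:{0..1}|lborel. F t)" if a: "0 \<le> a" "a \<le> 1" for a
  proof -
    \<comment> \<open>The interval of \<open>H\<close> is open at 0 so that the point t = 1 - a is
      counted only once in \<open>GH\<close>. Undoing the translations, \<open>G\<close> and
      \<open>H\<close> add up to \<open>F\<close> on the unit interval except possibly at 0 and
      \<open>a\<close>.\<close>
    define G where "G = (\<lambda>t. indicator {a..1} t *\<^sub>R F t)"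
    define H where "H = (\<lambda>t. indicator {0<..a} t *\<^sub>R F t)"
    have G: "integrable lborel G" and H: "integrable lborel H"
      unfolding G_def H_def set_integrable_def[symmetric]
      by (rule set_integrable_subset[OF F]; use a in auto)+
    have GH: "(indicator {0..1} t *\<^sub>R F (t + a) :: 'a) = G (a + 1 * t) + H ((a - 1) + 1 * t)" for t
      using a per[of "t + a - 1"] by (auto simp: G_def H_def indicator_def algebra_simps)
    have Gs: "integrable lborel (\<lambda>t. G (a + 1 * t))" "integrable lborel (\<lambda>t. H ((a - 1) + 1 * t))"
      by (intro lborel_integrable_real_affine G H; simp)+
    have "(LINT t|lborel. G (a + 1 * t) + H ((a - 1) + 1 * t)) = integral\<^sup>L lborel G + integral\<^sup>L lborel H"
      using Gs lborel_integral_real_affine[of 1 G a] lborel_integral_real_affine[of 1 H "a - 1"] by simp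
    also have "\<dots> = (LINT t|lborel. G t + H t)" using G H by simp
    also have "\<dots> = (LINT t|lborel. indicator {0..1} t *\<^sub>R F t)"
    proof (rule integral_cong_AE)
      show "(\<lambda>t. G t + H t) \<in> borel_measurable lborel" using G H by measurable
      show "(\<lambda>t. indicator {0..1} t *\<^sub>R F t) \<in> borel_measurable lborel"
        using F by (auto simp: set_integrable_def)
      show "AE t in lborel. G t + H t = indicator {0..1} t *\<^sub>R F t"
        using AE_lborel_singleton[of 0] AE_lborel_singleton[of a]
        by eventually_elim (use a in \<open>auto simp: G_def H_def indicator_def\<close>)
    qed
    finally show ?thesis
      using Gs unfolding set_integrable_def set_lebesgue_integral_def GH by auto
  qed
  \<comment> \<open>Both signs lead to an \<open>a\<close> in [0, 1]: either -\<theta> itself or, by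
    periodicity, 1 - \<theta>.\<close>
  have "set_integrable lborel {0..1} (\<lambda>t. F (t - \<theta>)) \<and>
     (LINT t:{0..1}|lborel. F (t - \<theta>)) = (LINT t:{0..1}|lborel. F t)"
  proof (cases "\<theta> \<le> 0")
    case True thus ?thesis using main[of "- \<theta>"] \<theta> by simp
  next
    case False
    have "F (t + (1 - \<theta>)) = F (t - \<theta>)" for t using per[of "t - \<theta>"] by (simp add: algebra_simps)
    thus ?thesis using main[of "1 - \<theta>"] \<theta> False by simp
  qed
  thus "set_integrable lborel {0..1} (\<lambda>t. F (t - \<theta>))"
    "(LINT t:{0..1}|lborel. F (t - \<theta>)) = (LINT t:{0..1}|lborel. F t)" by auto
qed

lemma L2perD:
  assumes "f \<in> L2per"
  shows "f \<in> borel_measurable borel" "f (t + 1) = f t" "set_integrable lborel {0..1} (\<lambda>t. (f t)\<^sup>2)"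
  using assms by (auto simp: L2per_def)

lemma L2per_shift:
  assumes "f \<in> L2per" "\<theta> \<in> {-1/2..1/2}"
  shows "(\<lambda>t. f (t - \<theta>)) \<in> L2per"
proof -
  note [measurable] = L2perD(1)[OF assms(1)]
  have "f (t + 1 - \<theta>) = f (t - \<theta>)" for t
    using L2perD(2)[OF assms(1), of "t - \<theta>"] by (simp add: algebra_simps)
  moreover have "set_integrable lborel {0..1} (\<lambda>t. (f (t - \<theta>))\<^sup>2)"
    using set_integrable_periodic_shift[of "\<lambda>t. (f t)\<^sup>2" \<theta>] L2perD[OF assms(1)] assms(2) by simp
  ultimately show ?thesis by (auto simp: L2per_def)
qed

lemma L2per_diff:
  assumes "f \<in> L2per" "h \<in> L2per"
  shows "(\<lambda>t. f t - h t) \<in> L2per"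
proof -
  note [measurable] = L2perD(1)[OF assms(1)] L2perD(1)[OF assms(2)]
  have "integrable unit_measure (\<lambda>t. (f t - h t)\<^sup>2)"
  proof (rule Bochner_Integration.integrable_bound)
    show "integrable unit_measure (\<lambda>t. 2 * (f t)\<^sup>2 + 2 * (h t)\<^sup>2)"
      using L2perD(3)[OF assms(1)] L2perD(3)[OF assms(2)]
      by (simp add: integrable_unit_measure_iff[symmetric])
    have "(\<lambda>t. (f t - h t)\<^sup>2) \<in> borel_measurable borel" by measurable
    thus "(\<lambda>t. (f t - h t)\<^sup>2) \<in> borel_measurable unit_measure"
      by (intro measurable_restrict_space1) simp
    have "(x - y)\<^sup>2 \<le> 2 * x\<^sup>2 + 2 * y\<^sup>2" for x y :: real
      using zero_le_power2[of "x + y"] by (simp add: power2_eq_square algebra_simps)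
    thus "AE t in unit_measure. norm ((f t - h t)\<^sup>2) \<le> norm (2 * (f t)\<^sup>2 + 2 * (h t)\<^sup>2)" by simp
  qed
  thus ?thesis using L2perD[OF assms(1)] L2perD[OF assms(2)]
    by (auto simp: L2per_def integrable_unit_measure_iff)
qed

lemma fourier_coeff_diff:
  assumes "f \<in> L2per" "h \<in> L2per"
  shows "fourier_coeff (\<lambda>t. f t - h t) k = fourier_coeff f k - fourier_coeff h k"
  using integrable_square_times_cis[OF L2perD(1,3)[OF assms(1)], of "- (2 * pi * of_int k)"]
    integrable_square_times_cis[OF L2perD(1,3)[OF assms(2)], of "- (2 * pi * of_int k)"]
  by (simp add: fourier_coeff_unit_measure left_diff_distrib)

text \<open>A shift multiplies the coefficient by a phase of modulus one. Since \<open>k\<close> is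
  an integer, the integrand \<open>F\<close> is itself 1-periodic, and its integral does not change
  under the shift.\<close>

lemma cmod_fourier_coeff_shift:
  assumes f: "f \<in> L2per" and \<theta>: "\<theta> \<in> {-1/2..1/2}"
  shows "cmod (fourier_coeff (\<lambda>t. f (t - \<theta>)) k) = cmod (fourier_coeff f k)"
proof -
  define F where "F = (\<lambda>t. complex_of_real (f t) * cis (- (2 * pi * of_int k * t)))"
  have per: "F (t + 1) = F t" for t
  proof -
    have "cis (- (2 * pi * of_int k * (t + 1))) = cis (- (2 * pi * of_int k * t)) * cis (2 * pi * of_int (- k))"
      unfolding cis_mult by (simp add: algebra_simps)
    also have "cis (2 * pi * of_int (- k)) = 1" by (rule cis_multiple_2pi) simp
    finally show ?thesis using L2perD(2)[OF f] by (simp add: F_def)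
  qed
  have F: "set_integrable lborel {0..1} F"
    using integrable_square_times_cis[OF L2perD(1,3)[OF f], of "- (2 * pi * of_int k)"]
    by (simp add: F_def integrable_unit_measure_iff)
  have "complex_of_real (f (t - \<theta>)) * cis (- (2 * pi * of_int k * t)) =
      cis (- (2 * pi * of_int k * \<theta>)) * F (t - \<theta>)" for t
    by (simp add: F_def cis_mult algebra_simps)
  hence "fourier_coeff (\<lambda>t. f (t - \<theta>)) k = cis (- (2 * pi * of_int k * \<theta>)) * integral\<^sup>L unit_measure (\<lambda>t. F (t - \<theta>))"
    by (simp add: fourier_coeff_unit_measure)
  also have "integral\<^sup>L unit_measure (\<lambda>t. F (t - \<theta>)) = fourier_coeff f k"
    using set_integral_periodic_shift[OF per F \<theta>]
    by (simp add: fourier_coeff_unit_measure integral_unit_measure F_def)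
  finally show ?thesis by (simp add: norm_mult)
qed

text \<open>Bessel's inequality for the difference, followed by the reverse triangle inequality in
  each coefficient. Passing to moduli weakens the bound but makes it invariant under shifts.\<close>

lemma L2dist_ge_fourier:
  assumes "f \<in> L2per" "h \<in> L2per" "finite K"
  shows "(\<Sum>k\<in>K. (cmod (fourier_coeff f k) - cmod (fourier_coeff h k))\<^sup>2) \<le> (L2dist f h)\<^sup>2"
proof -
  have "(\<Sum>k\<in>K. (cmod (fourier_coeff f k) - cmod (fourier_coeff h k))\<^sup>2) \<le>
      (\<Sum>k\<in>K. (cmod (fourier_coeff (\<lambda>t. f t - h t) k))\<^sup>2)"
    unfolding fourier_coeff_diff[OF assms(1,2)]
    by (intro sum_mono) (metis abs_le_square_iff norm_triangle_ineq3 abs_norm_cancel)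
  also have "\<dots> \<le> (LINT t:{0..1}|lborel. (f t - h t)\<^sup>2)"
    using L2perD[OF L2per_diff[OF assms(1,2)]] assms(3) by (intro bessel_inequality)
  also have "\<dots> = (L2dist f h)\<^sup>2"
    by (simp add: L2dist_def set_lebesgue_integral_def)
  finally show ?thesis .
qed

text \<open>The bound for \<open>L2dist\<close> is the same for every shift of \<open>f\<close>, so
  it survives the infimum.\<close>

lemma shift_dist_ge_fourier:
  assumes "f \<in> L2per" "h \<in> L2per" "finite K"
  shows "(\<Sum>k\<in>K. (cmod (fourier_coeff f k) - cmod (fourier_coeff h k))\<^sup>2) \<le> (shift_dist f h)\<^sup>2"
proof -
  let ?S = "\<Sum>k\<in>K. (cmod (fourier_coeff f k) - cmod (fourier_coeff h k))\<^sup>2"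
  have S: "0 \<le> ?S" by (simp add: sum_nonneg)
  have "sqrt ?S \<le> shift_dist f h"
    unfolding shift_dist_def
  proof (rule cINF_greatest)
    fix \<theta> :: real assume \<theta>: "\<theta> \<in> {-1/2..1/2}"
    have "?S \<le> (L2dist (\<lambda>t. f (t - \<theta>)) h)\<^sup>2"
      using L2dist_ge_fourier[OF L2per_shift[OF assms(1) \<theta>] assms(2,3)]
      by (simp add: cmod_fourier_coeff_shift[OF assms(1) \<theta>])
    moreover have "0 \<le> L2dist (\<lambda>t. f (t - \<theta>)) h"
      by (simp add: L2dist_def set_lebesgue_integral_def)
    ultimately show "sqrt ?S \<le> L2dist (\<lambda>t. f (t - \<theta>)) h" by (rule real_le_lsqrt[rotated])
  qed simp
  hence "(sqrt ?S)\<^sup>2 \<le> (shift_dist f h)\<^sup>2" using S by (intro power_mono) auto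
  thus ?thesis using S by simp
qed

lemma space_L2borel [simp]: "space L2borel = L2per"
  by (simp add: L2borel_def space_measure_of_conv)

text \<open>The map is 1-Lipschitz for \<open>L2dist\<close>, so preimages of open sets belong to
  the generator of \<open>L2borel\<close>.\<close>

lemma measurable_cmod_fourier_coeff:
  "(\<lambda>f. cmod (fourier_coeff f k)) \<in> borel_measurable L2borel"
proof (rule borel_measurableI)
  fix S :: "real set" assume S: "open S"
  let ?U = "(\<lambda>f. cmod (fourier_coeff f k)) -` S \<inter> L2per"
  have "\<exists>e>0. \<forall>h\<in>L2per. L2dist f h < e \<longrightarrow> h \<in> ?U" if f: "f \<in> ?U" for f
  proof -
    from f S obtain e where e: "e > 0" "\<And>y. \<bar>y - cmod (fourier_coeff f k)\<bar> < e \<Longrightarrow> y \<in> S"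
      by (auto simp: open_dist dist_real_def)
    have "h \<in> ?U" if h: "h \<in> L2per" "L2dist f h < e" for h
    proof -
      have "(cmod (fourier_coeff f k) - cmod (fourier_coeff h k))\<^sup>2 \<le> (L2dist f h)\<^sup>2"
        using L2dist_ge_fourier[of f h "{k}"] f h by auto
      moreover have "0 \<le> L2dist f h" by (simp add: L2dist_def set_lebesgue_integral_def)
      ultimately have "\<bar>cmod (fourier_coeff f k) - cmod (fourier_coeff h k)\<bar> \<le> L2dist f h"
        using power2_le_iff_abs_le by blast
      thus ?thesis using e(2) h by auto
    qed
    thus ?thesis using e(1) by blast
  qed
  hence "?U \<in> {U. U \<subseteq> L2per \<and> (\<forall>f\<in>U. \<exists>e>0. \<forall>h\<in>L2per. L2dist f h < e \<longrightarrow> h \<in> U)}" by blast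
  thus "(\<lambda>f. cmod (fourier_coeff f k)) -` S \<inter> space L2borel \<in> sets L2borel"
    by (simp add: L2borel_def sets_measure_of_conv sigma_sets.Basic Pow_def subset_eq)
qed

section \<open>The hypotheses\<close>

text \<open>The symmetric range enters each nonzero frequency twice, as m and -m; for even
  \<open>w\<close> this makes \<open>w m\<close> the Fourier coefficient itself rather than twice
  that coefficient.\<close>

definition cosine_poly :: "int \<Rightarrow> (int \<Rightarrow> real) \<Rightarrow> real \<Rightarrow> real" where
  "cosine_poly N w t = (\<Sum>m\<in>{-N..N}. w m * cos (2 * pi * of_int m * t))"

lemma continuous_on_cosine_poly: "continuous_on UNIV (cosine_poly N w)"
  unfolding cosine_poly_def by (intro continuous_intros)

lemma cosine_poly_L2per: "cosine_poly N w \<in> L2per"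
proof -
  have per: "cosine_poly N w (t + 1) = cosine_poly N w t" for t
  proof -
    have "cos (2 * pi * of_int m * (t + 1)) = cos (2 * pi * of_int m * t)" for m
    proof -
      have "2 * pi * of_int m * (t + 1) = 2 * pi * of_int m * t + 2 * pi * of_int m"
        by (simp add: algebra_simps)
      thus ?thesis by (simp add: cos_add cos_int_2pin sin_int_2pin)
    qed
    thus ?thesis by (simp add: cosine_poly_def)
  qed
  have "set_integrable lborel {0..1} (\<lambda>t. (cosine_poly N w t)\<^sup>2)"
    unfolding integrable_unit_measure_iff[symmetric]
    by (intro integrable_unit_measure_continuous continuous_intros continuous_on_cosine_poly)
  thus ?thesis
    using per borel_measurable_continuous_onI[OF continuous_on_cosine_poly]
    by (auto simp: L2per_def)
qed

lemma fourier_coeff_cosine_poly: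
  assumes even: "\<And>m. w (- m) = w m"
  shows "fourier_coeff (cosine_poly N w) k = (if \<bar>k\<bar> \<le> N then of_real (w k) else 0)"
proof -
  let ?e = "\<lambda>j t. cis (2 * pi * of_int j * t)"
  have ei: "integrable unit_measure (?e j)" for j
    by (intro integrable_unit_measure_continuous continuous_intros)
  have eq: "of_real (cosine_poly N w t) * cis (- (2 * pi * of_int k * t)) =
      (\<Sum>m\<in>{-N..N}. of_real (w m / 2) * (?e (m - k) t + ?e (- m - k) t))" for t
  proof -
    have "of_real (cos x) = (cis x + cis (- x)) / 2" for x :: real
      by (simp add: complex_eq_iff)
    hence "of_real (cos (2 * pi * of_int m * t)) * cis (- (2 * pi * of_int k * t)) =
        (?e (m - k) t + ?e (- m - k) t) / 2" for m :: int
      by (simp only: distrib_right cis_mult times_divide_eq_left)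
        (simp add: left_diff_distrib right_diff_distrib add.commute minus_diff_commute)
    hence "of_real (w m * cos (2 * pi * of_int m * t)) * cis (- (2 * pi * of_int k * t)) =
        of_real (w m / 2) * (?e (m - k) t + ?e (- m - k) t)" for m
      by (simp only: of_real_mult mult.assoc) simp
    thus ?thesis
      unfolding cosine_poly_def of_real_sum sum_distrib_right by (simp only:)
  qed
  have "fourier_coeff (cosine_poly N w) k =
      (\<Sum>m\<in>{-N..N}. of_real (w m / 2) * (integral\<^sup>L unit_measure (?e (m - k)) + integral\<^sup>L unit_measure (?e (- m - k))))"
    unfolding fourier_coeff_unit_measure eq
    by (subst Bochner_Integration.integral_sum)
      (auto intro!: sum.cong integrable_mult_right Bochner_Integration.integrable_add ei
        simp: Bochner_Integration.integral_add[OF ei ei] simp del: of_int_diff of_real_divide)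
  \<comment> \<open>The indices m = k and m = -k contribute half of \<open>w k\<close> each; for k =
    0 both halves come from the single index 0.\<close>
  also have "\<dots> = (\<Sum>m\<in>{-N..N}. (if m = k then of_real (w k / 2) else 0) + (if m = - k then of_real (w k / 2) else 0))"
    unfolding integral_cis_unit by (intro sum.cong refl) (auto simp: even)
  also have "\<dots> = (if \<bar>k\<bar> \<le> N then of_real (w k) else 0)"
    unfolding sum.distrib by auto
  finally show ?thesis .
qed

definition hypothesis_weight :: "real \<Rightarrow> real \<Rightarrow> int set \<Rightarrow> int \<Rightarrow> real" where
  "hypothesis_weight c r E m = (if \<bar>m\<bar> = 1 then c else if \<bar>m\<bar> \<in> E then r else 0)"

abbreviation hypothesis :: "int \<Rightarrow> real \<Rightarrow> real \<Rightarrow> int set \<Rightarrow> real \<Rightarrow> real" where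
  "hypothesis N c r E \<equiv> cosine_poly (2 * N) (hypothesis_weight c r E)"

text \<open>The frequencies 1 and -1 cost 2 c^2 each. At most 2N further frequencies are active,
  none beyond 2N in modulus, and each costs at most \<open>D\<close>, because 1 + |k|^(2s) \<le> 2
  (2N)^(2s).\<close>

lemma hypothesis_Wtilde:
  assumes N: "N \<ge> 1" and E: "E \<subseteq> {N+1..2*N}" and "c > 0" "s > 0"
    and le: "4 * c\<^sup>2 + 4 * of_int N * (of_int (2 * N)) powr (2 * s) * r\<^sup>2 \<le> A\<^sup>2"
  shows "hypothesis N c r E \<in> Wtilde s A c"
proof -
  let ?w = "hypothesis_weight c r E" and ?f = "hypothesis N c r E"
  define T where "T = (\<lambda>k::int. (1 + \<bar>of_int k\<bar> powr (2 * s)) * (cmod (fourier_coeff ?f k))\<^sup>2)"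
  have fc: "fourier_coeff ?f k = (if \<bar>k\<bar> \<le> 2 * N then of_real (?w k) else 0)" for k
    by (rule fourier_coeff_cosine_poly) (simp add: hypothesis_weight_def)
  have "T k = 0" if "k \<notin> {-2*N..2*N}" for k
    using that by (auto simp: T_def fc)
  hence T: "(T has_sum (sum T {-2*N..2*N})) UNIV"
    by (intro has_sum_finite_neutralI) auto
  define D where "D = 2 * (of_int (2 * N)) powr (2 * s) * r\<^sup>2"
  have D0: "D \<ge> 0" by (simp add: D_def)
  have "sum T {-2*N..2*N} \<le> (\<Sum>k\<in>{-2*N..2*N}. (if k \<in> {1, -1} then 2 * c\<^sup>2 else 0) +
      (if k \<in> {N+1..2*N} \<union> {-2*N..-N-1} then D else 0))"
  proof (rule sum_mono)
    fix k assume k: "k \<in> {-2*N..2*N}"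
    consider "\<bar>k\<bar> = 1" | "\<bar>k\<bar> \<noteq> 1" "\<bar>k\<bar> \<in> E" | "\<bar>k\<bar> \<noteq> 1" "\<bar>k\<bar> \<notin> E" by blast
    thus "T k \<le> (if k \<in> {1, -1} then 2 * c\<^sup>2 else 0) +
      (if k \<in> {N+1..2*N} \<union> {-2*N..-N-1} then D else 0)"
    proof cases
      case 1
      have "\<bar>real_of_int k\<bar> = 1" using 1 by linarith
      hence "T k = 2 * c\<^sup>2" using 1 N by (simp add: T_def fc hypothesis_weight_def)
      moreover have "k \<in> {1, -1}" using 1 by auto
      ultimately show ?thesis using D0 by simp
    next
      case 2
      have k2: "\<bar>k\<bar> \<in> {N+1..2*N}" using 2 E by auto
      have "1 \<le> real_of_int (2 * N) powr (2 * s)"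
        using N \<open>s > 0\<close> by (intro ge_one_powr_ge_zero) auto
      moreover have "\<bar>real_of_int k\<bar> powr (2 * s) \<le> real_of_int (2 * N) powr (2 * s)"
        using k2 \<open>s > 0\<close> by (intro powr_mono2) (auto simp flip: of_int_abs)
      ultimately have "(1 + \<bar>real_of_int k\<bar> powr (2 * s)) * r\<^sup>2 \<le> D"
        unfolding D_def by (intro mult_right_mono) auto
      moreover have "T k = (1 + \<bar>real_of_int k\<bar> powr (2 * s)) * r\<^sup>2"
        using 2 k2 by (simp add: T_def fc hypothesis_weight_def)
      moreover have "k \<in> {N+1..2*N} \<union> {-2*N..-N-1}" using k2 by auto
      ultimately show ?thesis using 2 by auto
    next
      case 3
      hence "T k = 0" by (simp add: T_def fc hypothesis_weight_def)
      thus ?thesis using D0 by auto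
    qed
  qed
  also have "\<dots> = (\<Sum>k\<in>{-2*N..2*N} \<inter> {1, -1}. 2 * c\<^sup>2) +
      (\<Sum>k\<in>{-2*N..2*N} \<inter> ({N+1..2*N} \<union> {-2*N..-N-1}). D)"
    unfolding sum.distrib by (subst (1 2) sum.inter_restrict) auto
  also have "{-2*N..2*N} \<inter> {1, -1} = {1, -1}" using N by auto
  also have "{-2*N..2*N} \<inter> ({N+1..2*N} \<union> {-2*N..-N-1}) = {N+1..2*N} \<union> {-2*N..-N-1}" using N by auto
  also have "(\<Sum>k\<in>{N+1..2*N} \<union> {-2*N..-N-1}. D) = 2 * of_int N * D"
    using N by (subst sum.union_disjoint) auto
  also have "(\<Sum>k\<in>{1, -1::int}. 2 * c\<^sup>2) = 4 * c\<^sup>2" by simp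
  also have "4 * c\<^sup>2 + 2 * of_int N * D \<le> A\<^sup>2" using le by (simp add: D_def mult_ac)
  finally have "sum T {-2*N..2*N} \<le> A\<^sup>2" .
  hence "T summable_on UNIV" "(\<Sum>\<^sub>\<infinity>k. T k) \<le> A\<^sup>2"
    using has_sum_imp_summable[OF T] infsumI[OF T] by simp_all
  moreover have "cmod (fourier_coeff ?f 1) = c"
    using N \<open>c > 0\<close> by (simp add: fc hypothesis_weight_def)
  ultimately show ?thesis
    using cosine_poly_L2per continuous_on_cosine_poly by (simp add: Wtilde_def T_def)
qed

text \<open>Only the two terms at \<open>k\<close> and \<open>-k\<close> change, by at most
  \<open>r\<close> each. Uniformity in \<open>t\<close> is what makes the bound usable at all design
  points for every value of the shifts.\<close>

lemma hypothesis_flip: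
  assumes "k \<in> {N+1..2*N}" "N \<ge> 1" "k \<notin> E" "r \<ge> 0"
  shows "\<bar>hypothesis N c r E t - hypothesis N c r (insert k E) t\<bar> \<le> 2 * r"
proof -
  have "\<bar>hypothesis N c r E t - hypothesis N c r (insert k E) t\<bar> \<le>
      (\<Sum>m\<in>{-(2*N)..2*N}. \<bar>(hypothesis_weight c r E m - hypothesis_weight c r (insert k E) m) * cos (2 * pi * of_int m * t)\<bar>)"
    unfolding cosine_poly_def sum_subtractf[symmetric] left_diff_distrib[symmetric] by (rule sum_abs)
  also have "\<dots> \<le> (\<Sum>m\<in>{-(2*N)..2*N}. if m \<in> {k, -k} then r else 0)"
  proof (rule sum_mono)
    fix m
    have "\<bar>hypothesis_weight c r E m - hypothesis_weight c r (insert k E) m\<bar> \<le> (if m \<in> {k, -k} then r else 0)"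
      using assms by (auto simp: hypothesis_weight_def)
    moreover have "\<bar>x * cos y\<bar> \<le> \<bar>x\<bar>" for x y :: real
      using abs_cos_le_one[of y] by (simp add: abs_mult mult_left_le)
    ultimately show "\<bar>(hypothesis_weight c r E m - hypothesis_weight c r (insert k E) m) * cos (2 * pi * of_int m * t)\<bar>
        \<le> (if m \<in> {k, -k} then r else 0)"
      using order_trans by blast
  qed
  also have "\<dots> = (\<Sum>m\<in>{-(2*N)..2*N} \<inter> {k, -k}. r)" by (subst sum.inter_restrict) auto
  also have "{-(2*N)..2*N} \<inter> {k, -k} = {k, -k}" using assms by auto
  also have "(\<Sum>m\<in>{k, -k}. r) = 2 * r" using assms by simp
  finally show ?thesis .
qed

section \<open>The lower bound\<close>

text \<open>For fixed \<open>k\<close> the cube splits into pairs \<open>E\<close>,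
  \<open>insert k E\<close>, so \<open>R k\<close> averages at least b/2 over the cube. Summing over
  \<open>k\<close> and exchanging the sums bounds the average of the total loss, which is at most
  \<open>S\<close>.\<close>

lemma assouad_hypercube:
  fixes R :: "'k \<Rightarrow> 'k set \<Rightarrow> ennreal"
  assumes K: "finite K"
    and pair: "\<And>k E. k \<in> K \<Longrightarrow> E \<subseteq> K - {k} \<Longrightarrow> b \<le> R k E + R k (insert k E)"
    and S: "\<And>E. E \<subseteq> K \<Longrightarrow> (\<Sum>k\<in>K. R k E) \<le> S"
  shows "of_nat (card K) * b \<le> 2 * S"
proof (cases "K = {}")
  case False
  \<comment> \<open>Each coordinate has 2^m pairs and the cube has 2 * 2^m vertices, which produces
    the factor 2 in front of \<open>S\<close>.\<close>
  then obtain m where m: "card K = Suc m" using K by (metis card_eq_0_iff not0_implies_Suc)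
  have "2 ^ m * b \<le> (\<Sum>E\<in>Pow K. R k E)" if k: "k \<in> K" for k
  proof -
    have fin: "finite (Pow (K - {k}))" using K by simp
    have inj: "inj_on (insert k) (Pow (K - {k}))" by (auto simp: inj_on_def)
    have "Pow K = Pow (K - {k}) \<union> insert k ` Pow (K - {k})"
      using Pow_insert[of k "K - {k}"] k by (simp add: insert_absorb)
    hence "(\<Sum>E\<in>Pow K. R k E) = (\<Sum>E\<in>Pow (K - {k}). R k E) + (\<Sum>E\<in>insert k ` Pow (K - {k}). R k E)"
      using fin by (simp only:) (subst sum.union_disjoint, auto)
    also have "\<dots> = (\<Sum>E\<in>Pow (K - {k}). R k E + R k (insert k E))"
      by (simp add: sum.reindex[OF inj] sum.distrib)
    also have "\<dots> \<ge> (\<Sum>E\<in>Pow (K - {k}). b)"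
      using pair[OF k] by (intro sum_mono) auto
    also have "(\<Sum>E\<in>Pow (K - {k}). b) = 2 ^ m * b"
      using K k m by (simp add: card_Pow card_Diff_singleton)
    finally show ?thesis .
  qed
  hence "(\<Sum>k\<in>K. 2 ^ m * b) \<le> (\<Sum>k\<in>K. \<Sum>E\<in>Pow K. R k E)" by (rule sum_mono)
  also have "\<dots> = (\<Sum>E\<in>Pow K. \<Sum>k\<in>K. R k E)" by (rule sum.swap)
  also have "\<dots> \<le> (\<Sum>E\<in>Pow K. S)" using S by (intro sum_mono) auto
  also have "\<dots> = 2 ^ m * (2 * S)" using K m by (simp add: card_Pow mult_ac)
  finally have "2 ^ m * (of_nat (card K) * b) \<le> 2 ^ m * (2 * S)" by (simp add: mult_ac)
  moreover have "(2 ^ m :: ennreal) = ennreal (2 ^ m)" by (simp add: ennreal_power[symmetric])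
  ultimately show ?thesis by (simp add: ennreal_mult_le_mult_iff)
qed simp

section \<open>Two hypotheses in the observation model\<close>

lemma prob_space_shift_density:
  assumes "g \<in> shift_densities \<kappa>"
  shows "prob_space (density lborel (\<lambda>x. ennreal (g x)))"
proof
  have "g \<in> borel_measurable borel" using assms by (simp add: shift_densities_def)
  hence "emeasure (density lborel (\<lambda>x. ennreal (g x))) UNIV = (\<integral>\<^sup>+ x. ennreal (g x) \<partial>lborel)"
    by (subst emeasure_density) auto
  thus "emeasure (density lborel (\<lambda>x. ennreal (g x))) (space (density lborel (\<lambda>x. ennreal (g x)))) = 1"
    using assms by (simp add: shift_densities_def)
qed

lemma measurable_observation:
  assumes [measurable]: "f \<in> borel_measurable borel"
  shows "observation f n J \<in> model \<sigma> g n J \<rightarrow>\<^sub>M (\<Pi>\<^sub>M lj\<in>{1..n} \<times> {1..J}. borel)"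
proof -
  have "(\<lambda>\<omega>. f (real l / real n - fst \<omega> j) + snd \<omega> (l, j)) \<in> borel_measurable (model \<sigma> g n J)"
    if lj: "l \<in> {1..n}" "j \<in> {1..J}" for l j
  proof -
    have "(\<lambda>\<omega>. fst \<omega> j) \<in> borel_measurable (model \<sigma> g n J)"
      unfolding model_def using lj by measurable
    moreover have "(\<lambda>x. x (l, j)) \<in> borel_measurable (\<Pi>\<^sub>M lj\<in>{1..n} \<times> {1..J}. normal_measure 0 \<sigma>)"
      using measurable_component_singleton[of "(l, j)" "{1..n} \<times> {1..J}" "\<lambda>_. normal_measure 0 \<sigma>"] lj by simp
    hence "(\<lambda>\<omega>. snd \<omega> (l, j)) \<in> borel_measurable (model \<sigma> g n J)"
      unfolding model_def by measurable
    ultimately show ?thesis by measurable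
  qed
  thus ?thesis
    unfolding observation_def case_prod_beta by (intro measurable_restrict) auto
qed

lemma model_two_point:
  fixes \<phi> :: "(nat \<times> nat \<Rightarrow> real) \<Rightarrow> real"
  assumes g: "g \<in> shift_densities \<kappa>" and "\<sigma> > 0" "r \<ge> 0"
    and [measurable]: "f \<in> borel_measurable borel" "f' \<in> borel_measurable borel"
      "\<phi> \<in> borel_measurable (\<Pi>\<^sub>M lj\<in>{1..n} \<times> {1..J}. borel)"
    and close: "\<And>t. \<bar>f t - f' t\<bar> \<le> B" "real n * real J * B\<^sup>2 \<le> 2 * \<sigma>\<^sup>2"
  shows "ennreal (r\<^sup>2 / 4) \<le> (\<integral>\<^sup>+ \<omega>. ennreal ((\<phi> (observation f n J \<omega>))\<^sup>2) \<partial>model \<sigma> g n J) +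
    (\<integral>\<^sup>+ \<omega>. ennreal ((\<phi> (observation f' n J \<omega>) - r)\<^sup>2) \<partial>model \<sigma> g n J)"
proof -
  let ?I = "{1..n} \<times> {1..J}"
  let ?Q = "\<Pi>\<^sub>M j\<in>{1..J}. density lborel (\<lambda>x. ennreal (g x))"
  let ?P = "\<Pi>\<^sub>M lj\<in>?I. normal_measure 0 \<sigma>"
  interpret Q: prob_space ?Q by (intro prob_space_PiM prob_space_shift_density[OF g])
  interpret P: prob_space ?P by (intro prob_space_PiM prob_space_normal_density assms)
  note [measurable] = measurable_observation[where \<sigma> = \<sigma> and g = g and n = n and J = J]
  define F where "F = (\<lambda>\<omega>. ennreal ((\<phi> (observation f n J \<omega>))\<^sup>2) + ennreal ((\<phi> (observation f' n J \<omega>) - r)\<^sup>2))"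
  have F: "F \<in> borel_measurable (?Q \<Otimes>\<^sub>M ?P)"
    unfolding F_def model_def[symmetric] by measurable
  have "ennreal (r\<^sup>2 / 4) = (\<integral>\<^sup>+ \<theta>. ennreal (r\<^sup>2 / 4) \<partial>?Q)" by (simp add: Q.emeasure_space_1 del: One_nat_def)
  \<comment> \<open>Both hypotheses share the law of the shifts, so they are compared for each fixed
    \<theta> as Gaussian vectors. The bound is constant in \<theta> and integrates to
    itself.\<close>
  also have "\<dots> \<le> (\<integral>\<^sup>+ \<theta>. \<integral>\<^sup>+ \<epsilon>. F (\<theta>, \<epsilon>) \<partial>?P \<partial>?Q)"
  proof (rule nn_integral_mono)
    fix \<theta> :: "nat \<Rightarrow> real"
    define \<mu> where "\<mu> = (\<lambda>f (l, j). f (real l / real n - \<theta> j) :: real)"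
    have obs: "observation h n J (\<theta>, \<epsilon>) = (\<lambda>i\<in>?I. \<mu> h i + \<epsilon> i)" for h \<epsilon>
      by (auto simp: observation_def \<mu>_def fun_eq_iff)
    have "(\<Sum>i\<in>?I. (\<mu> f i - \<mu> f' i)\<^sup>2) \<le> (\<Sum>i\<in>?I. B\<^sup>2)"
    proof (rule sum_mono)
      fix i
      have "\<bar>\<mu> f i - \<mu> f' i\<bar> \<le> B" using close(1) by (simp add: \<mu>_def case_prod_beta)
      thus "(\<mu> f i - \<mu> f' i)\<^sup>2 \<le> B\<^sup>2" by (simp add: abs_le_square_iff[symmetric])
    qed
    also have "\<dots> = real n * real J * B\<^sup>2" by simp
    finally have "(\<Sum>i\<in>?I. (\<mu> f i - \<mu> f' i)\<^sup>2) \<le> 2 * \<sigma>\<^sup>2" using close(2) by simp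
    from normal_two_point[OF _ assms(2,3) assms(6) this]
    have "ennreal (r\<^sup>2 / 4) \<le> (\<integral>\<^sup>+ \<epsilon>. ennreal ((\<phi> (observation f n J (\<theta>, \<epsilon>)))\<^sup>2) \<partial>?P) +
        (\<integral>\<^sup>+ \<epsilon>. ennreal ((\<phi> (observation f' n J (\<theta>, \<epsilon>)) - r)\<^sup>2) \<partial>?P)"
      by (simp add: obs)
    also have "\<dots> = (\<integral>\<^sup>+ \<epsilon>. F (\<theta>, \<epsilon>) \<partial>?P)"
    proof -
      have [measurable]: "(\<lambda>\<epsilon>. observation h n J (\<theta>, \<epsilon>)) \<in> ?P \<rightarrow>\<^sub>M (\<Pi>\<^sub>M lj\<in>?I. borel)" for h
        unfolding obs by measurable
      show ?thesis unfolding F_def by (rule nn_integral_add[symmetric]) measurable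
    qed
    finally show "ennreal (r\<^sup>2 / 4) \<le> (\<integral>\<^sup>+ \<epsilon>. F (\<theta>, \<epsilon>) \<partial>?P)" .
  qed
  also have "\<dots> = integral\<^sup>N (model \<sigma> g n J) F"
    unfolding model_def by (rule P.nn_integral_fst[OF F])
  also have "\<dots> = (\<integral>\<^sup>+ \<omega>. ennreal ((\<phi> (observation f n J \<omega>))\<^sup>2) \<partial>model \<sigma> g n J) +
    (\<integral>\<^sup>+ \<omega>. ennreal ((\<phi> (observation f' n J \<omega>) - r)\<^sup>2) \<partial>model \<sigma> g n J)"
    unfolding F_def by (rule nn_integral_add) measurable
  finally show ?thesis .
qed

section \<open>From the minimax risk to the hypercube\<close>

lemma measurable_estimator_fourier:
  assumes "fhat \<in> estimators n J"
  shows "(\<lambda>y. cmod (fourier_coeff (fhat y) k)) \<in> borel_measurable (\<Pi>\<^sub>M lj\<in>{1..n} \<times> {1..J}. borel)"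
  using measurable_compose[OF assms[unfolded estimators_def] measurable_cmod_fourier_coeff] .

text \<open>Replaces the shift distance by a loss that is additive over frequencies, the form
  required by \<open>assouad_hypercube\<close>.\<close>

lemma risk_ge_fourier:
  assumes fhat: "fhat \<in> estimators n J" and f: "f \<in> L2per" and K: "finite K"
  shows "(\<Sum>k\<in>K. \<integral>\<^sup>+ \<omega>. ennreal ((cmod (fourier_coeff (fhat (observation f n J \<omega>)) k) -
    cmod (fourier_coeff f k))\<^sup>2) \<partial>model \<sigma> g n J) \<le> risk \<sigma> g n J fhat f"
proof -
  note [measurable] = measurable_observation[OF L2perD(1)[OF f], of n J \<sigma> g]
    measurable_estimator_fourier[OF fhat]
  have "(\<Sum>k\<in>K. \<integral>\<^sup>+ \<omega>. ennreal ((cmod (fourier_coeff (fhat (observation f n J \<omega>)) k) -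
    cmod (fourier_coeff f k))\<^sup>2) \<partial>model \<sigma> g n J) =
    (\<integral>\<^sup>+ \<omega>. (\<Sum>k\<in>K. ennreal ((cmod (fourier_coeff (fhat (observation f n J \<omega>)) k) -
    cmod (fourier_coeff f k))\<^sup>2)) \<partial>model \<sigma> g n J)"
    by (rule nn_integral_sum[symmetric]) measurable
  also have "\<dots> \<le> risk \<sigma> g n J fhat f"
    unfolding risk_def
  proof (rule nn_integral_mono)
    fix \<omega> assume "\<omega> \<in> space (model \<sigma> g n J)"
    hence "fhat (observation f n J \<omega>) \<in> L2per"
      using measurable_space[OF fhat[unfolded estimators_def]]
        measurable_space[OF measurable_observation[OF L2perD(1)[OF f], of n J \<sigma> g]] by simp
    from shift_dist_ge_fourier[OF this f K]
    show "(\<Sum>k\<in>K. ennreal ((cmod (fourier_coeff (fhat (observation f n J \<omega>)) k) -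
        cmod (fourier_coeff f k))\<^sup>2)) \<le> ennreal ((shift_dist (fhat (observation f n J \<omega>)) f)\<^sup>2)"
      by (simp add: sum_ennreal ennreal_leI)
  qed
  finally show ?thesis .
qed

text \<open>A single member of the class suffices as a witness, because the supremum over densities
  dominates the value at any of them.\<close>

lemma uniform_shift_density:
  assumes "0 < \<kappa>" "\<kappa> \<le> 1"
  shows "(\<lambda>x. indicator {-\<kappa>/2..\<kappa>/2} x / \<kappa>) \<in> shift_densities \<kappa>"
proof -
  have "(\<integral>\<^sup>+ x. ennreal (indicator {-\<kappa>/2..\<kappa>/2} x / \<kappa>) \<partial>lborel) =
      (\<integral>\<^sup>+ x. ennreal (1 / \<kappa>) * indicator {-\<kappa>/2..\<kappa>/2} x \<partial>lborel)"
    by (intro nn_integral_cong) (simp add: indicator_def)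
  also have "\<dots> = ennreal (1 / \<kappa>) * ennreal \<kappa>"
    using assms by (subst nn_integral_cmult_indicator) auto
  also have "\<dots> = 1" using assms by (simp add: ennreal_mult'[symmetric])
  finally have "(\<integral>\<^sup>+ x. ennreal (indicator {-\<kappa>/2..\<kappa>/2} x / \<kappa>) \<partial>lborel) = 1" .
  moreover have "closure {x. indicator {-\<kappa>/2..\<kappa>/2} x / \<kappa> \<noteq> 0} \<subseteq> {-\<kappa>/2..\<kappa>/2}"
    by (rule closure_minimal) (auto simp: indicator_def)
  ultimately show ?thesis
    using assms by (auto simp: shift_densities_def indicator_def)
qed

text \<open>There are N coordinates, each with two-point bound r^2/4, and Assouad's factor 2 turns
  their total into N r^2/8. The parameters \<open>N\<close> and \<open>r\<close> stay free here,
  subject only to the smoothness and noise constraints.\<close>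

lemma minimax_risk_ge:
  assumes "c > 0" "\<sigma> > 0" "s > 0" "r \<ge> 0" "N \<ge> 1" and g: "g \<in> shift_densities \<kappa>"
    and smooth: "4 * c\<^sup>2 + 4 * of_int N * (of_int (2 * N)) powr (2 * s) * r\<^sup>2 \<le> A\<^sup>2"
    and noise: "2 * (real n * real J * r\<^sup>2) \<le> \<sigma>\<^sup>2"
  shows "ennreal (of_int N * r\<^sup>2 / 8) \<le> minimax_risk \<sigma> n J (Wtilde s A c) (shift_densities \<kappa>)"
  unfolding minimax_risk_def
proof (rule INF_greatest)
  fix fhat assume fhat: "fhat \<in> estimators n J"
  let ?S = "SUP g\<in>shift_densities \<kappa>. SUP f\<in>Wtilde s A c. risk \<sigma> g n J fhat f"
  let ?K = "{N+1..2*N}"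
  define \<phi> where "\<phi> = (\<lambda>k y. cmod (fourier_coeff (fhat y) k))"
  have [measurable]: "\<phi> k \<in> borel_measurable (\<Pi>\<^sub>M lj\<in>{1..n} \<times> {1..J}. borel)" for k
    unfolding \<phi>_def by (rule measurable_estimator_fourier[OF fhat])
  define R where "R = (\<lambda>k E. \<integral>\<^sup>+ \<omega>. ennreal ((\<phi> k (observation (hypothesis N c r E) n J \<omega>) -
    (if k \<in> E then r else 0))\<^sup>2) \<partial>model \<sigma> g n J)"
  have "of_nat (card ?K) * ennreal (r\<^sup>2 / 4) \<le> 2 * ?S"
  proof (rule assouad_hypercube[where R = R])
    fix k E assume k: "k \<in> ?K" and E: "E \<subseteq> ?K - {k}"
    hence kE: "k \<notin> E" by auto
    have meas: "hypothesis N c r E \<in> borel_measurable borel" for E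
      by (rule L2perD(1)[OF cosine_poly_L2per])
    have "ennreal (r\<^sup>2 / 4) \<le> (\<integral>\<^sup>+ \<omega>. ennreal ((\<phi> k (observation (hypothesis N c r E) n J \<omega>))\<^sup>2) \<partial>model \<sigma> g n J) +
      (\<integral>\<^sup>+ \<omega>. ennreal ((\<phi> k (observation (hypothesis N c r (insert k E)) n J \<omega>) - r)\<^sup>2) \<partial>model \<sigma> g n J)"
    proof (rule model_two_point[OF g])
      \<comment> \<open>The uniform gap 2r between the two functions gives a squared distance of
        means of at most 4 n J r^2.\<close>
      show "real n * real J * (2 * r)\<^sup>2 \<le> 2 * \<sigma>\<^sup>2" using noise by (simp add: power_mult_distrib mult_ac)
      show "\<bar>hypothesis N c r E t - hypothesis N c r (insert k E) t\<bar> \<le> 2 * r" for t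
        by (rule hypothesis_flip) (use k kE assms in auto)
    qed (use assms meas in measurable)
    thus "ennreal (r\<^sup>2 / 4) \<le> R k E + R k (insert k E)" using kE by (simp add: R_def)
  next
    fix E assume E: "E \<subseteq> ?K"
    let ?f = "hypothesis N c r E"
    have fc: "cmod (fourier_coeff ?f k) = (if k \<in> E then r else 0)" if "k \<in> ?K" for k
      using that E assms by (subst fourier_coeff_cosine_poly) (auto simp: hypothesis_weight_def)
    have "(\<Sum>k\<in>?K. R k E) = (\<Sum>k\<in>?K. \<integral>\<^sup>+ \<omega>. ennreal ((cmod (fourier_coeff (fhat (observation ?f n J \<omega>)) k) -
        cmod (fourier_coeff ?f k))\<^sup>2) \<partial>model \<sigma> g n J)"
      by (intro sum.cong refl) (simp add: R_def \<phi>_def fc)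
    also have "\<dots> \<le> risk \<sigma> g n J fhat ?f"
      by (rule risk_ge_fourier[OF fhat cosine_poly_L2per]) simp
    also have "\<dots> \<le> ?S"
      using hypothesis_Wtilde[OF _ E _ _ smooth] assms by (intro SUP_upper2[OF g] SUP_upper) auto
    finally show "(\<Sum>k\<in>?K. R k E) \<le> ?S" .
  qed simp
  also have "of_nat (card ?K) * ennreal (r\<^sup>2 / 4) = 2 * ennreal (of_int N * r\<^sup>2 / 8)"
  proof -
    have "of_nat (card ?K) * ennreal (r\<^sup>2 / 4) = ennreal (real (card ?K) * (r\<^sup>2 / 4))"
      unfolding ennreal_of_nat_eq_real_of_nat by (rule ennreal_mult'[symmetric]) simp
    also have "real (card ?K) * (r\<^sup>2 / 4) = 2 * (of_int N * r\<^sup>2 / 8)" using assms by simp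
    also have "ennreal \<dots> = 2 * ennreal (of_int N * r\<^sup>2 / 8)" by (subst ennreal_mult') auto
    finally show ?thesis .
  qed
  finally have "ennreal 2 * ennreal (of_int N * r\<^sup>2 / 8) \<le> ennreal 2 * ?S" by simp
  thus "ennreal (of_int N * r\<^sup>2 / 8) \<le> ?S" by (subst (asm) ennreal_mult_le_mult_iff) auto
qed

text \<open>The strict inequality \<open>2 * c < A\<close> leaves room for perturbations: for A < 2c
  the class is empty, and for A = 2c it is a single orbit under shifts, which a constant estimator
  recovers with zero risk. Choosing \<open>C\<close> before \<open>\<kappa>\<close> expresses that
  it is independent of \<open>\<kappa>\<close>.\<close>

theorem theorem4p1:
  fixes A c \<sigma> s :: real
  assumes "A > 0" and "c > 0" and "\<sigma> > 0" and "s > 1 / 2"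
    and "2 * c < A"
  shows "\<exists>C::real. C > 0 \<and> (\<forall>\<kappa>::real. 0 < \<kappa> \<and> \<kappa> < 1 / 8 \<longrightarrow>
    Liminf (filtercomap (\<lambda>(n, J). min n J) (at_top :: nat filter))
      (\<lambda>(n, J). ennreal ((real n * real J) powr (2 * s / (2 * s + 1))) *
        minimax_risk \<sigma> n J (Wtilde s A c) (shift_densities \<kappa>)) \<ge> ennreal C)"
proof -
  \<comment> \<open>With r^2 = \<eta> / (n J), the first bound on \<eta> yields the noise constraint
    and the second the smoothness constraint.\<close>
  define \<eta> where "\<eta> = min (\<sigma>\<^sup>2 / 2) ((A\<^sup>2 - 4 * c\<^sup>2) / (4 * 2 powr (2 * s)))"
  have "(2 * c)\<^sup>2 < A\<^sup>2" using assms by (intro power_strict_mono) auto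
  hence \<eta>: "\<eta> > 0" using assms by (simp add: \<eta>_def power_mult_distrib)
  have \<eta>1: "2 * \<eta> \<le> \<sigma>\<^sup>2" by (simp add: \<eta>_def)
  have "\<eta> \<le> (A\<^sup>2 - 4 * c\<^sup>2) / (4 * 2 powr (2 * s))" by (simp add: \<eta>_def)
  hence \<eta>2: "4 * c\<^sup>2 + 4 * 2 powr (2 * s) * \<eta> \<le> A\<^sup>2" by (simp add: field_simps)
  \<comment> \<open>The bound is not merely asymptotic: it holds for all positive \<open>n\<close>
    and \<open>J\<close>.\<close>
  have bound: "ennreal (\<eta> / 16) \<le> ennreal ((real n * real J) powr (2 * s / (2 * s + 1))) *
      minimax_risk \<sigma> n J (Wtilde s A c) (shift_densities \<kappa>)"
    if \<kappa>: "0 < \<kappa>" "\<kappa> < 1 / 8" and nJ: "min n J \<ge> 1" for \<kappa> n J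
  proof -
    \<comment> \<open>This solves x^(2s+1) = n J, the largest order of \<open>N\<close> for which
      N^(2s+1) r^2 stays bounded.\<close>
    define x where "x = (real n * real J) powr (1 / (2 * s + 1))"
    define N where "N = \<lfloor>x\<rfloor>"
    define r where "r = sqrt (\<eta> / (real n * real J))"
    have "1 * 1 \<le> real n * real J" using nJ by (intro mult_mono) auto
    hence M: "1 \<le> real n * real J" by simp
    hence x1: "x \<ge> 1" using assms by (simp add: x_def ge_one_powr_ge_zero)
    have xM: "x powr (2 * s + 1) = real n * real J"
      using assms M by (simp add: x_def powr_powr)
    have xs: "(real n * real J) powr (2 * s / (2 * s + 1)) = x powr (2 * s)"
      by (simp add: x_def powr_powr)
    have N1: "N \<ge> 1" and Nx: "real_of_int N \<le> x" using x1 by (auto simp: N_def)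
    have "x < real_of_int N + 1" by (simp add: N_def)
    \<comment> \<open>Rounding down costs at most a factor 2, as x < N + 1 \<le> 2N.\<close>
    hence N2: "x / 2 \<le> real_of_int N" using N1 by linarith
    have r2: "r\<^sup>2 = \<eta> / (real n * real J)" using \<eta> M by (simp add: r_def)
    have "ennreal (of_int N * r\<^sup>2 / 8) \<le> minimax_risk \<sigma> n J (Wtilde s A c) (shift_densities \<kappa>)"
    proof (rule minimax_risk_ge)
      show "2 * (real n * real J * r\<^sup>2) \<le> \<sigma>\<^sup>2" using \<eta>1 M by (simp add: r2)
      have "real_of_int N * real_of_int (2 * N) powr (2 * s) = 2 powr (2 * s) * real_of_int N powr (2 * s + 1)"
        using N1 by (simp add: powr_mult powr_add)
      also have "\<dots> \<le> 2 powr (2 * s) * (real n * real J)"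
        unfolding xM[symmetric] using N1 Nx assms by (intro mult_left_mono powr_mono2) auto
      finally have "4 * (real_of_int N * real_of_int (2 * N) powr (2 * s)) * r\<^sup>2
          \<le> 4 * (2 powr (2 * s) * (real n * real J)) * r\<^sup>2"
        by (intro mult_right_mono mult_left_mono) auto
      also have "\<dots> = 4 * 2 powr (2 * s) * \<eta>" using M by (auto simp: r2)
      finally show "4 * c\<^sup>2 + 4 * of_int N * (of_int (2 * N)) powr (2 * s) * r\<^sup>2 \<le> A\<^sup>2"
        using \<eta>2 by (simp add: mult.assoc)
      show "(\<lambda>x. indicator {-\<kappa>/2..\<kappa>/2} x / \<kappa>) \<in> shift_densities \<kappa>"
        using \<kappa> by (intro uniform_shift_density) auto
      show "r \<ge> 0" using \<eta> by (simp add: r_def)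
    qed (use assms N1 in auto)
    hence "ennreal (x powr (2 * s)) * ennreal (of_int N * r\<^sup>2 / 8) \<le>
        ennreal (x powr (2 * s)) * minimax_risk \<sigma> n J (Wtilde s A c) (shift_densities \<kappa>)"
      by (rule mult_left_mono) simp
    moreover have "\<eta> / 16 \<le> x powr (2 * s) * (of_int N * r\<^sup>2 / 8)"
    proof -
      \<comment> \<open>The normalising factor x^(2s) times x r^2 is exactly \<eta>; the 16 combines
        the 8 of \<open>minimax_risk_ge\<close> with the rounding factor 2.\<close>
      have "\<eta> / 16 = x powr (2 * s) * (x / 2 * r\<^sup>2 / 8)"
        using x1 unfolding r2 xM[symmetric] by (simp add: powr_add)
      also have "\<dots> \<le> x powr (2 * s) * (of_int N * r\<^sup>2 / 8)"
        using N2 by (intro mult_left_mono divide_right_mono mult_right_mono) auto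
      finally show ?thesis .
    qed
    ultimately show ?thesis
      unfolding xs ennreal_mult'[OF powr_ge_zero, symmetric] by (rule order_trans[OF ennreal_leI, rotated])
  qed
  have "ennreal (\<eta> / 16) \<le> Liminf (filtercomap (\<lambda>(n, J). min n J) (at_top :: nat filter))
      (\<lambda>(n, J). ennreal ((real n * real J) powr (2 * s / (2 * s + 1))) *
        minimax_risk \<sigma> n J (Wtilde s A c) (shift_densities \<kappa>))"
    if "0 < \<kappa>" "\<kappa> < 1 / 8" for \<kappa>
  proof (rule Liminf_bounded)
    show "\<forall>\<^sub>F p in filtercomap (\<lambda>(n, J). min n J) (at_top :: nat filter). ennreal (\<eta> / 16) \<le>
      (case p of (n, J) \<Rightarrow> ennreal ((real n * real J) powr (2 * s / (2 * s + 1))) *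
        minimax_risk \<sigma> n J (Wtilde s A c) (shift_densities \<kappa>))"
      unfolding eventually_filtercomap
      by (rule exI[of _ "\<lambda>m. m \<ge> 1"]) (use bound[OF that] in \<open>auto simp: eventually_ge_at_top\<close>)
  qed
  thus ?thesis using \<eta> by (intro exI[of _ "\<eta> / 16"]) auto
qed

end
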